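(* Let $\boldsymbol{p}=\prod_{k=1}^K[\underline p_k,\overline p_k]\subset\mathbb{R}^K$ be a box with $\underline p_k\le\overline p_k$, let $A^{(0)},\dots,A^{(K)}\in\mathbb{R}^{n\times n}$, let $A(p)=A^{(0)}+\sum_{k=1}^K A^{(k)}p_k$, and suppose that the parametric interval matrix $A(\boldsymbol{p})$ is symmetric, i.e. $A(p)$ is a symmetric matrix for every $p\in\boldsymbol{p}$. Then the following assertions are equivalent: (i) $A(\boldsymbol{p})$ is stable; (ii) $A(p)$ is stable for each $p\in\mathbb{R}^K$ such that $p_k\in\{\underline p_k,\overline p_k\}$ for all $k=1,\dots,K$; (iii) $-A(\boldsymbol{p})$ is strongly positive definite, i.e. $-A(p)$ is positive definite for each $p\in\boldsymbol{p}$.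
   Context: A parametric interval matrix with affine-linear dependencies is a family $A(\boldsymbol{p})=\{A(p)=A^{(0)}+\sum_{k=1}^K A^{(k)}p_k \mid p\in\boldsymbol{p}\}$ of real $n\times n$ matrices, where $\boldsymbol{p}$ is a product of compact intervals. $-A(\boldsymbol{p})$ denotes the family $\{-A(p)\mid p\in\boldsymbol{p}\}$. A real square matrix is stable (Hurwitz) if every eigenvalue has strictly negative real part. $A(\boldsymbol{p})$ is stable if $A(p)$ is stable for each $p\in\boldsymbol{p}$. A parametric interval matrix is strongly positive definite if each of its members, over all $p\in\boldsymbol{p}$, is positive definite. *)

theory Defs
  imports "HOL-Analysis.Analysis"
begin

definition parametric_matrix ::
  "real^'n^'n \<Rightarrow> ('k::finite \<Rightarrow> real^'n^'n) \<Rightarrow> real^'k \<Rightarrow> real^'n^'n" where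
  "parametric_matrix A0 A p = A0 + (\<Sum>k\<in>UNIV. (p $ k) *\<^sub>R A k)"

text \<open>On \<^typ>\<open>real^'k\<close> the set \<^term>\<open>cbox l u\<close> is the product of the intervals
  from \<^term>\<open>l $ k\<close> to \<^term>\<open>u $ k\<close> (see \<open>mem_box_cart\<close>).\<close>

definition parametric_interval_matrix ::
  "real^'n^'n \<Rightarrow> ('k::finite \<Rightarrow> real^'n^'n) \<Rightarrow> real^'k \<Rightarrow> real^'k \<Rightarrow> (real^'n^'n) set" where
  "parametric_interval_matrix A0 A l u = parametric_matrix A0 A ` cbox l u"

text \<open>Eigenvalues of a real matrix are its complex ones, so the matrix is first
  embedded entrywise into the complex matrices.\<close>

definition complex_matrix :: "real^'n^'m \<Rightarrow> complex^'n^'m" where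
  "complex_matrix M = (\<chi> i j. complex_of_real (M $ i $ j))"

definition eigenvalue :: "'a::field^'n^'n \<Rightarrow> 'a \<Rightarrow> bool" where
  "eigenvalue M c \<longleftrightarrow> (\<exists>v. v \<noteq> 0 \<and> M *v v = c *s v)"

definition stable_matrix :: "real^'n^'n \<Rightarrow> bool" where
  "stable_matrix M \<longleftrightarrow> (\<forall>c. eigenvalue (complex_matrix M) c \<longrightarrow> Re c < 0)"

definition symmetric_matrix :: "real^'n^'n \<Rightarrow> bool" where
  "symmetric_matrix M \<longleftrightarrow> transpose M = M"

definition positive_definite :: "real^'n^'n \<Rightarrow> bool" where
  "positive_definite M \<longleftrightarrow> (\<forall>x. x \<noteq> 0 \<longrightarrow> 0 < x \<bullet> (M *v x))"

definition stable_family :: "(real^'n^'n) set \<Rightarrow> bool" where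
  "stable_family S \<longleftrightarrow> (\<forall>M\<in>S. stable_matrix M)"

definition symmetric_family :: "(real^'n^'n) set \<Rightarrow> bool" where
  "symmetric_family S \<longleftrightarrow> (\<forall>M\<in>S. symmetric_matrix M)"

definition strongly_positive_definite :: "(real^'n^'n) set \<Rightarrow> bool" where
  "strongly_positive_definite S \<longleftrightarrow> (\<forall>M\<in>S. positive_definite M)"

end

theory Submission
  imports Defs
begin

text \<open>
  For a symmetric matrix, stability is negative definiteness of the quadratic form
  \<open>x \<bullet> (M *v x)\<close>. One direction reads the real part of an eigenvalue off the form at
  the real and imaginary parts of an eigenvector; the other uses that the maximum of the form
  on the unit sphere is attained at an eigenvector, hence is an eigenvalue, which stability
  makes negative. This is \<open>stable_matrix_iff_negative_definite\<close>.

  For a fixed \<open>x\<close>, the number \<open>x \<bullet> (A(p) *v x)\<close> is affine in \<open>p\<close>, so over the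
  box it is largest at a vertex (\<open>quadratic_form_le_vertex\<close>). The vertex depends on
  \<open>x\<close>, but negative definiteness at all vertices still gives negative definiteness on the
  whole box. All three assertions are thereby the same statement about quadratic forms.
\<close>

text \<open>
  Writing \<open>v = a + \<i> b\<close> and \<open>c = s + \<i> t\<close>, the eigenvalue equation becomes
  \<open>M a = s a - t b\<close> and \<open>M b = s b + t a\<close>. The terms with \<open>t\<close> cancel in
  \<open>a \<bullet> M a + b \<bullet> M b\<close>, leaving \<open>s (|a|\<^sup>2 + |b|\<^sup>2)\<close>.
\<close>

lemma negative_definite_imp_stable_matrix:
  fixes M :: "real^'n^'n"
  assumes neg: "\<And>x. x \<noteq> 0 \<Longrightarrow> x \<bullet> (M *v x) < 0"
  shows "stable_matrix M"
  unfolding stable_matrix_def eigenvalue_def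
proof (intro allI impI, elim exE conjE)
  fix c :: complex and v :: "complex^'n"
  assume "v \<noteq> 0" and eig: "complex_matrix M *v v = c *s v"
  define a b :: "real^'n" where "a = (\<chi> i. Re (v $ i))" and "b = (\<chi> i. Im (v $ i))"
  have entry: "(\<Sum>j\<in>UNIV. complex_of_real (M $ i $ j) * v $ j) = c * v $ i" for i
    using eig by (simp add: vec_eq_iff matrix_vector_mult_def complex_matrix_def)
  have Ma: "M *v a = Re c *\<^sub>R a - Im c *\<^sub>R b"
    using arg_cong[OF entry, of Re]
    by (simp add: vec_eq_iff a_def b_def matrix_vector_mult_def)
  have Mb: "M *v b = Re c *\<^sub>R b + Im c *\<^sub>R a"
    using arg_cong[OF entry, of Im]
    by (simp add: vec_eq_iff a_def b_def matrix_vector_mult_def)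
  have sum: "a \<bullet> (M *v a) + b \<bullet> (M *v b) = Re c * (a \<bullet> a + b \<bullet> b)"
    by (simp add: Ma Mb inner_commute algebra_simps)
  have nonzero: "a \<noteq> 0 \<or> b \<noteq> 0"
    using \<open>v \<noteq> 0\<close> by (auto simp: vec_eq_iff a_def b_def complex_eq_iff)
  have nonpos: "x \<bullet> (M *v x) \<le> 0" for x
    using neg[of x] by (cases "x = 0") auto
  have "a \<bullet> (M *v a) + b \<bullet> (M *v b) < 0"
    using nonzero neg[of a] neg[of b] nonpos[of a] nonpos[of b] by linarith
  moreover have "0 \<le> a \<bullet> a + b \<bullet> b"
    by simp
  ultimately show "Re c < 0"
    unfolding sum by (simp add: mult_less_0_iff)
qed

lemma eigenvalue_complex_matrix_of_real:
  fixes M :: "real^'n^'n"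
  assumes "x \<noteq> 0" and "M *v x = r *\<^sub>R x"
  shows "eigenvalue (complex_matrix M) (complex_of_real r)"
  unfolding eigenvalue_def
proof (intro exI conjI)
  let ?v = "\<chi> i. complex_of_real (x $ i)"
  show "?v \<noteq> 0"
    using assms(1) by (auto simp: vec_eq_iff)
  have "(\<Sum>j\<in>UNIV. M $ i $ j * x $ j) = r * x $ i" for i
    using assms(2) by (simp add: vec_eq_iff matrix_vector_mult_def)
  then have "(\<Sum>j\<in>UNIV. complex_of_real (M $ i $ j) * complex_of_real (x $ j))
      = complex_of_real r * complex_of_real (x $ i)" for i
    by (metis (no_types, lifting) of_real_mult of_real_sum sum.cong)
  then show "complex_matrix M *v ?v = complex_of_real r *s ?v"
    by (simp add: vec_eq_iff matrix_vector_mult_def complex_matrix_def)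
qed

lemma symmetric_matrix_inner:
  assumes "symmetric_matrix M"
  shows "x \<bullet> (M *v y) = y \<bullet> (M *v x)"
  using assms by (metis dot_lmul_matrix inner_commute symmetric_matrix_def transpose_matrix_vector)

text \<open>
  If \<open>N x \<noteq> 0\<close>, a short step from \<open>x\<close> against the gradient \<open>2 N x\<close> would make the
  form negative.
\<close>

lemma semidefinite_form_zero_imp_kernel:
  fixes N :: "real^'n^'n"
  assumes sym: "symmetric_matrix N"
    and nonneg: "\<And>y. 0 \<le> y \<bullet> (N *v y)"
    and zero: "x \<bullet> (N *v x) = 0"
  shows "N *v x = 0"
proof (rule ccontr)
  assume "N *v x \<noteq> 0"
  define y where "y = N *v x"
  define q where "q = y \<bullet> y"
  define d where "d = y \<bullet> (N *v y)"
  have "q > 0"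
    using \<open>N *v x \<noteq> 0\<close> by (simp add: q_def y_def)
  have "d \<ge> 0"
    using nonneg by (simp add: d_def)
  have xNy: "x \<bullet> (N *v y) = q"
    using symmetric_matrix_inner[OF sym, of x y] by (simp add: q_def y_def)
  \<comment> \<open>Along the step the form is \<open>t (t d - 2 q)\<close>; this \<open>t\<close> makes \<open>t d \<le> q\<close>.\<close>
  define t where "t = q / (d + 1)"
  have "t > 0" and td: "t * d \<le> q"
    using \<open>q > 0\<close> \<open>d \<ge> 0\<close> by (auto simp: t_def field_simps)
  have "(x - t *\<^sub>R y) \<bullet> (N *v (x - t *\<^sub>R y)) = t * (t * d - 2 * q)"
    using zero xNy
    by (simp add: matrix_vector_mult_diff_distrib matrix_vector_mult_scaleR inner_diff_left
        inner_diff_right q_def d_def flip: y_def) (simp add: algebra_simps)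
  moreover have "t * (t * d - 2 * q) < 0"
    using \<open>t > 0\<close> td \<open>q > 0\<close> by (simp add: mult_pos_neg)
  ultimately show False
    using nonneg[of "x - t *\<^sub>R y"] by simp
qed

text \<open>
  The largest value \<open>r\<close> of the form on the compact unit sphere is an eigenvalue: \<open>r I - M\<close>
  is positive semidefinite and its form vanishes at a maximizer.
\<close>

lemma symmetric_matrix_max_eigenvalue:
  fixes M :: "real^'n^'n"
  assumes sym: "symmetric_matrix M"
  obtains x r where "x \<noteq> 0" and "M *v x = r *\<^sub>R x" and "\<And>y. y \<bullet> (M *v y) \<le> r * (y \<bullet> y)"
proof -
  let ?S = "sphere (0 :: real^'n) 1"
  have "continuous_on ?S (\<lambda>x. x \<bullet> (M *v x))"
    by (intro continuous_intros matrix_vector_mult_linear_continuous_on)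
  moreover have "?S \<noteq> {}"
    by simp
  ultimately obtain x where x: "x \<in> ?S" and max: "\<forall>y\<in>?S. y \<bullet> (M *v y) \<le> x \<bullet> (M *v x)"
    using continuous_attains_sup[OF compact_sphere, of 0 1 "\<lambda>x. x \<bullet> (M *v x)"] by blast
  define r where "r = x \<bullet> (M *v x)"
  have xx: "x \<bullet> x = 1"
    using x by (simp add: dot_square_norm)
  have bound: "y \<bullet> (M *v y) \<le> r * (y \<bullet> y)" for y
  proof (cases "y = 0")
    case False
    have "(y /\<^sub>R norm y) \<bullet> (M *v (y /\<^sub>R norm y)) \<le> r"
      unfolding r_def using False by (intro max[rule_format]) simp
    then have "(y \<bullet> (M *v y)) / (norm y)\<^sup>2 \<le> r"
      by (simp add: matrix_vector_mult_scaleR power2_eq_square field_simps)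
    then show ?thesis
      using False by (simp add: pos_divide_le_eq power2_norm_eq_inner)
  qed simp
  define N where "N = r *\<^sub>R mat 1 - M"
  have N: "N *v y = r *\<^sub>R y - M *v y" for y
    by (simp add: N_def matrix_vector_mult_diff_rdistrib flip: scaleR_matrix_vector_assoc)
  have "symmetric_matrix N"
    using sym by (auto simp: symmetric_matrix_def N_def transpose_def vec_eq_iff mat_def)
  then have "N *v x = 0"
  proof (rule semidefinite_form_zero_imp_kernel)
    show "0 \<le> y \<bullet> (N *v y)" for y
      using bound[of y] by (simp add: N inner_diff_right)
    show "x \<bullet> (N *v x) = 0"
      by (simp add: N inner_diff_right r_def xx)
  qed
  then have "M *v x = r *\<^sub>R x"
    by (simp add: N)
  moreover have "x \<noteq> 0"
    using xx by auto
  ultimately show thesis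
    using that bound by blast
qed

lemma stable_matrix_iff_negative_definite:
  fixes M :: "real^'n^'n"
  assumes "symmetric_matrix M"
  shows "stable_matrix M \<longleftrightarrow> (\<forall>x. x \<noteq> 0 \<longrightarrow> x \<bullet> (M *v x) < 0)"
proof
  assume stable: "stable_matrix M"
  obtain z r where "z \<noteq> 0" and "M *v z = r *\<^sub>R z"
    and bound: "\<And>y. y \<bullet> (M *v y) \<le> r * (y \<bullet> y)"
    using symmetric_matrix_max_eigenvalue[OF assms] by blast
  then have "r < 0"
    using stable eigenvalue_complex_matrix_of_real unfolding stable_matrix_def by fastforce
  then show "\<forall>x. x \<noteq> 0 \<longrightarrow> x \<bullet> (M *v x) < 0"
    using bound by (meson inner_gt_zero_iff mult_neg_pos order_le_less_trans)
qed (simp add: negative_definite_imp_stable_matrix)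

lemma quadratic_form_parametric_matrix:
  "x \<bullet> (parametric_matrix A0 A p *v x)
    = x \<bullet> (A0 *v x) + (\<Sum>k\<in>UNIV. p $ k * (x \<bullet> (A k *v x)))"
proof -
  have "(\<Sum>k\<in>S. p $ k *\<^sub>R A k) *v x = (\<Sum>k\<in>S. p $ k *\<^sub>R (A k *v x))" for S
    by (induction S rule: infinite_finite_induct)
      (auto simp: matrix_vector_mult_add_rdistrib scaleR_matrix_vector_assoc)
  then show ?thesis
    by (simp add: parametric_matrix_def matrix_vector_mult_add_rdistrib inner_add_right
        inner_sum_right)
qed

lemma quadratic_form_le_vertex:
  fixes l u p :: "real^'k"
  assumes "p \<in> cbox l u"
  obtains v :: "real^'k" where "\<forall>k. v $ k \<in> {l $ k, u $ k}"
    and "x \<bullet> (parametric_matrix A0 A p *v x) \<le> x \<bullet> (parametric_matrix A0 A v *v x)"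
proof
  \<comment> \<open>The form has slope \<open>x \<bullet> (A k *v x)\<close> in the \<open>k\<close>-th parameter.\<close>
  let ?v = "\<chi> k. if 0 \<le> x \<bullet> (A k *v x) then u $ k else l $ k"
  show "\<forall>k. ?v $ k \<in> {l $ k, u $ k}"
    by simp
  have "p $ k * (x \<bullet> (A k *v x)) \<le> ?v $ k * (x \<bullet> (A k *v x))" for k
    using assms by (auto simp: mem_box_cart mult_right_mono mult_right_mono_neg)
  then show "x \<bullet> (parametric_matrix A0 A p *v x) \<le> x \<bullet> (parametric_matrix A0 A ?v *v x)"
    unfolding quadratic_form_parametric_matrix by (intro add_left_mono sum_mono)
qed

lemma positive_definite_uminus:
  fixes M :: "real^'n^'n"
  shows "positive_definite (- M) \<longleftrightarrow> (\<forall>x. x \<noteq> 0 \<longrightarrow> x \<bullet> (M *v x) < 0)"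
proof -
  have "(- M) *v x = - (M *v x)" for x
    by (simp add: vec_eq_iff matrix_vector_mult_def sum_negf)
  then show ?thesis
    by (simp add: positive_definite_def)
qed

theorem theorem4p2:
  fixes l u :: "real^'k"
    and A0 :: "real^'n^'n"
    and A :: "'k \<Rightarrow> real^'n^'n"
  assumes box: "\<forall>k. l $ k \<le> u $ k"
    and sym: "symmetric_family (parametric_interval_matrix A0 A l u)"
  shows "(stable_family (parametric_interval_matrix A0 A l u) \<longleftrightarrow>
            (\<forall>p::real^'k. (\<forall>k. p $ k \<in> {l $ k, u $ k}) \<longrightarrow> stable_matrix (parametric_matrix A0 A p)))
       \<and> ((\<forall>p::real^'k. (\<forall>k. p $ k \<in> {l $ k, u $ k}) \<longrightarrow> stable_matrix (parametric_matrix A0 A p)) \<longleftrightarrow>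
            strongly_positive_definite (uminus ` parametric_interval_matrix A0 A l u))"
proof -
  let ?M = "parametric_matrix A0 A"
  let ?neg = "\<lambda>p. \<forall>x. x \<noteq> 0 \<longrightarrow> x \<bullet> (?M p *v x) < 0"
  let ?vertex = "\<lambda>p::real^'k. \<forall>k. p $ k \<in> {l $ k, u $ k}"
  have vertex_in_box: "p \<in> cbox l u" if "?vertex p" for p
    unfolding mem_box_cart
  proof
    fix k
    have "p $ k = l $ k \<or> p $ k = u $ k"
      using that by simp
    then show "l $ k \<le> p $ k \<and> p $ k \<le> u $ k"
      using box by auto
  qed
  have stable_iff: "stable_matrix (?M p) \<longleftrightarrow> ?neg p" if "p \<in> cbox l u" for p
    using that sym stable_matrix_iff_negative_definite
    by (auto simp: symmetric_family_def parametric_interval_matrix_def)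
  have "stable_family (parametric_interval_matrix A0 A l u) \<longleftrightarrow> (\<forall>p\<in>cbox l u. ?neg p)"
    by (auto simp: stable_family_def parametric_interval_matrix_def stable_iff)
  moreover have "strongly_positive_definite (uminus ` parametric_interval_matrix A0 A l u)
      \<longleftrightarrow> (\<forall>p\<in>cbox l u. ?neg p)"
    by (auto simp: strongly_positive_definite_def parametric_interval_matrix_def
        positive_definite_uminus)
  moreover have "(\<forall>p. ?vertex p \<longrightarrow> stable_matrix (?M p)) \<longleftrightarrow> (\<forall>p\<in>cbox l u. ?neg p)"
  proof
    assume vertices: "\<forall>p. ?vertex p \<longrightarrow> stable_matrix (?M p)"
    show "\<forall>p\<in>cbox l u. ?neg p"
    proof (intro ballI allI impI)
      fix p and x :: "real^'n"
      assume "p \<in> cbox l u" and "x \<noteq> 0"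
      obtain v where v: "?vertex v" and le: "x \<bullet> (?M p *v x) \<le> x \<bullet> (?M v *v x)"
        using quadratic_form_le_vertex[OF \<open>p \<in> cbox l u\<close>] by blast
      have "?neg v"
        using vertices v vertex_in_box stable_iff by blast
      then show "x \<bullet> (?M p *v x) < 0"
        using le \<open>x \<noteq> 0\<close> by fastforce
    qed
  next
    assume "\<forall>p\<in>cbox l u. ?neg p"
    then show "\<forall>p. ?vertex p \<longrightarrow> stable_matrix (?M p)"
      using vertex_in_box stable_iff by blast
  qed
  ultimately show ?thesis
    by simp
qed

end
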